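(* Let $0\le t<1$ and $N\ge1$. For all signatures $\lambda,\mu,\nu,\rho\in\mathrm{Sig}_N$ with $\lambda\prec\mu\prec\rho$ and $\lambda\prec\nu\prec\rho$, the Hall-Littlewood RSK coefficients $U$ (defined in the context) satisfy $$U(\mu\to\rho\mid\lambda\to\nu)=U(\nu\to\rho\mid\lambda\to\mu).$$
   Context: A signature of length $N$ is a sequence of integers $\lambda_1\ge\dots\ge\lambda_N$; $\mathrm{Sig}_N$ is the set of these and $|\lambda|=\lambda_1+\dots+\lambda_N$. For $\lambda,\mu\in\mathrm{Sig}_N$ write $\lambda\prec\mu$ if $\mu_1\ge\lambda_1\ge\mu_2\ge\lambda_2\ge\dots\ge\mu_N\ge\lambda_N$. A signature $\kappa$ is viewed as $N$ particles on $\mathbb Z$ at positions $\kappa_1,\dots,\kappa_N$; moving a particle at position $k$ by $+1$ means replacing one coordinate equal to $k$ by $k+1$ (and reordering). Definition of $U(\mu\to\rho\mid\lambda\to\nu)$. It is $0$ unless $\lambda\prec\mu\prec\rho$, $\lambda\prec\nu\prec\rho$ and $|\nu|-|\lambda|=|\rho|-|\mu|$. Otherwise put $m=|\nu|-|\lambda|$, $n=|\mu|-|\lambda|$, and consider functions $\Lambda:\{0,\dots,m\}\times\{0,\dots,n\}\to\mathrm{Sig}_N$ with $\Lambda(0,0)=\lambda$, $\Lambda(m,0)=\nu$, $\Lambda(0,n)=\mu$, $\Lambda(m,n)=\rho$ such that: $\Lambda(i+1,j)$ is obtained from $\Lambda(i,j)$ by moving one particle, at position denoted $h_{i,j}$,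 by $+1$; $\Lambda(i,j+1)$ is obtained from $\Lambda(i,j)$ by moving one particle, at position denoted $v_{i,j}$, by $+1$; $h_{i,j}<h_{i+1,j}$ and $v_{i,j}<v_{i,j+1}$ whenever defined; and whenever $h_{i,j}=v_{i,j}=k$ (with $0\le i<m$, $0\le j<n$), one has $h_{i,j+1}=v_{i+1,j}\in\{k,k+1\}$. Such $\Lambda$ is called admissible; at most one exists. If none exists, $U:=0$. If it exists, let $b_{i,j}$ ($0\le i<m$, $0\le j<n$) be the unit box with south-west corner $(i,j)$. It is a zero-box if $h_{i,j}=v_{i,j}=h_{i,j+1}=v_{i+1,j}$; a one-box if $h_{i,j}=v_{i,j}=h_{i,j+1}-1=v_{i+1,j}-1$; and otherwise trivial (then $h_{i,j}=h_{i,j+1}\ne v_{i,j}=v_{i+1,j}$). Boxes outside the rectangle are considered trivial, and $h_{-1,j}=v_{i,-1}=-\infty$. For a zero-box or one-box $B=b_{i,j}$ put $r(B)=h_{i,j}=v_{i,j}$, $\bar r(B)=h_{i,j+1}=v_{i+1,j}$, and $c(B)=t^{\#}$, where $\#$ is the number of coordinates of $\Lambda(i,j)$ equal to $r(B)$. The weight $w(B)$ of $B=b_{i,j}$ is: (1) $w(B)=1$ if $B$ is trivial; or $B$ is a one-box and at least one of $b_{i-1,j},b_{i,j-1}$ is a one-box; or $B$ is a one-box and $b_{i-1,j-1}$ is a one-box with $\bar r(b_{i-1,j-1})=r(B)-1$; or $B$ is a zero-box and $b_{i-1,j-1}$ is a zero-box with $\bar r(b_{i-1,j-1})=r(B)-1$;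 (2) $w(B)=t$ if $B$ is a zero-box and exactly one of $h_{i-1,j},v_{i,j-1}$ equals $r(B)-1$; (3) $w(B)=1-t$ if $B$ is a one-box, $b_{i-1,j}$ and $b_{i,j-1}$ are trivial, and exactly one of $h_{i-1,j},v_{i,j-1}$ equals $r(B)-1$; (4) $w(B)=\frac{t-c(B)}{1-c(B)}$ if $B$ is a zero-box and $h_{i-1,j},v_{i,j-1}<r(B)-1$; (5) $w(B)=\frac{1-t}{1-c(B)}$ if $B$ is a one-box and $h_{i-1,j},v_{i,j-1}<r(B)-1$; (6) $w(B)=0$ if $B$ is a one-box and $b_{i-1,j-1}$ is a zero-box with $\bar r(b_{i-1,j-1})=r(B)-1$, or $B$ is a zero-box and $b_{i-1,j-1}$ is a one-box with $\bar r(b_{i-1,j-1})=r(B)-1$. Finally $U(\mu\to\rho\mid\lambda\to\nu):=\prod_{i=0}^{m-1}\prod_{j=0}^{n-1}w(b_{i,j})$. *)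

theory Defs
  imports "HOL-Library.Extended_Real" "HOL-Library.FuncSet" "HOL-Library.Multiset"
begin

text \<open>A signature of length \<open>N\<close> is a weakly decreasing list; the coordinate written
  \<open>\<kappa>\<^sub>p\<close> with 1-based index \<open>p\<close> on paper is \<open>\<kappa> ! (p - 1)\<close> here.\<close>

definition Sig :: "nat \<Rightarrow> int list set" where
  "Sig N = {\<kappa>. length \<kappa> = N \<and> sorted_wrt (\<ge>) \<kappa>}"

definition interlaces :: "int list \<Rightarrow> int list \<Rightarrow> bool"  (infix "\<prec>" 50) where
  "\<kappa> \<prec> \<kappa>' \<longleftrightarrow> length \<kappa> = length \<kappa>' \<and>
     (\<forall>p < length \<kappa>. \<kappa>' ! p \<ge> \<kappa> ! p) \<and>
     (\<forall>p. Suc p < length \<kappa> \<longrightarrow> \<kappa> ! p \<ge> \<kappa>' ! Suc p)"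

text \<open>Replace one coordinate \<open>k\<close> by \<open>k + 1\<close> and reorder. Comparing multisets suffices,
  since a signature is determined by the multiset of its coordinates.\<close>

definition moves :: "int list \<Rightarrow> int \<Rightarrow> int list \<Rightarrow> bool" where
  "moves \<kappa> k \<kappa>' \<longleftrightarrow> k \<in> set \<kappa> \<and> mset \<kappa>' = mset \<kappa> - {#k#} + {#k + 1#}"

text \<open>\<open>\<kappa>\<close> and \<open>\<kappa>'\<close> determine the position of the moved particle, so \<open>h\<close> and \<open>v\<close> are
  functions of the array.\<close>

definition moved_position :: "int list \<Rightarrow> int list \<Rightarrow> int" where
  "moved_position \<kappa> \<kappa>' = (THE k. moves \<kappa> k \<kappa>')"

type_synonym sig_array = "int \<times> int \<Rightarrow> int list"

definition h :: "sig_array \<Rightarrow> int \<Rightarrow> int \<Rightarrow> int" where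
  "h \<Lambda> i j = moved_position (\<Lambda> (i, j)) (\<Lambda> (i + 1, j))"

definition v :: "sig_array \<Rightarrow> int \<Rightarrow> int \<Rightarrow> int" where
  "v \<Lambda> i j = moved_position (\<Lambda> (i, j)) (\<Lambda> (i, j + 1))"

text \<open>Arrays are extensional (\<open>\<rightarrow>\<^sub>E\<close>), so that uniqueness of an admissible array is not
  spoiled by values outside the rectangle.\<close>

definition admissible ::
  "nat \<Rightarrow> int list \<Rightarrow> int list \<Rightarrow> int list \<Rightarrow> int list \<Rightarrow> int \<Rightarrow> int \<Rightarrow> sig_array \<Rightarrow> bool" where
  "admissible N lam mu nu rho m n \<Lambda> \<longleftrightarrow>
     \<Lambda> \<in> {0..m} \<times> {0..n} \<rightarrow>\<^sub>E Sig N \<and>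
     \<Lambda> (0, 0) = lam \<and> \<Lambda> (m, 0) = nu \<and> \<Lambda> (0, n) = mu \<and> \<Lambda> (m, n) = rho \<and>
     (\<forall>i\<in>{0..<m}. \<forall>j\<in>{0..n}. \<exists>k. moves (\<Lambda> (i, j)) k (\<Lambda> (i + 1, j))) \<and>
     (\<forall>i\<in>{0..m}. \<forall>j\<in>{0..<n}. \<exists>k. moves (\<Lambda> (i, j)) k (\<Lambda> (i, j + 1))) \<and>
     (\<forall>i\<in>{0..<m - 1}. \<forall>j\<in>{0..n}. h \<Lambda> i j < h \<Lambda> (i + 1) j) \<and>
     (\<forall>i\<in>{0..m}. \<forall>j\<in>{0..<n - 1}. v \<Lambda> i j < v \<Lambda> i (j + 1)) \<and>
     (\<forall>i\<in>{0..<m}. \<forall>j\<in>{0..<n}. h \<Lambda> i j = v \<Lambda> i j \<longrightarrow>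
        h \<Lambda> i (j + 1) = v \<Lambda> (i + 1) j \<and> h \<Lambda> i (j + 1) \<in> {h \<Lambda> i j, h \<Lambda> i j + 1})"

text \<open>The pair \<open>(i, j)\<close> stands for the box with south-west corner \<open>(i, j)\<close>. The range
  conditions below make all boxes outside the rectangle trivial.\<close>

definition zero_box :: "int \<Rightarrow> int \<Rightarrow> sig_array \<Rightarrow> int \<Rightarrow> int \<Rightarrow> bool" where
  "zero_box m n \<Lambda> i j \<longleftrightarrow> 0 \<le> i \<and> i < m \<and> 0 \<le> j \<and> j < n \<and>
     h \<Lambda> i j = v \<Lambda> i j \<and> h \<Lambda> i (j + 1) = h \<Lambda> i j \<and> v \<Lambda> (i + 1) j = h \<Lambda> i j"

definition one_box :: "int \<Rightarrow> int \<Rightarrow> sig_array \<Rightarrow> int \<Rightarrow> int \<Rightarrow> bool" where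
  "one_box m n \<Lambda> i j \<longleftrightarrow> 0 \<le> i \<and> i < m \<and> 0 \<le> j \<and> j < n \<and>
     h \<Lambda> i j = v \<Lambda> i j \<and> h \<Lambda> i (j + 1) - 1 = h \<Lambda> i j \<and> v \<Lambda> (i + 1) j - 1 = h \<Lambda> i j"

definition trivial_box :: "int \<Rightarrow> int \<Rightarrow> sig_array \<Rightarrow> int \<Rightarrow> int \<Rightarrow> bool" where
  "trivial_box m n \<Lambda> i j \<longleftrightarrow> \<not> zero_box m n \<Lambda> i j \<and> \<not> one_box m n \<Lambda> i j"

definition box_r :: "sig_array \<Rightarrow> int \<Rightarrow> int \<Rightarrow> int" where
  "box_r \<Lambda> i j = h \<Lambda> i j"

definition box_rbar :: "sig_array \<Rightarrow> int \<Rightarrow> int \<Rightarrow> int" where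
  "box_rbar \<Lambda> i j = h \<Lambda> i (j + 1)"

definition box_c :: "real \<Rightarrow> sig_array \<Rightarrow> int \<Rightarrow> int \<Rightarrow> real" where
  "box_c t \<Lambda> i j = t ^ count_list (\<Lambda> (i, j)) (box_r \<Lambda> i j)"

text \<open>\<open>hW\<close> and \<open>vS\<close> are \<open>h\<close> at \<open>(i - 1, j)\<close> and \<open>v\<close> at \<open>(i, j - 1)\<close>, with value
  \<open>-\<infinity>\<close> off the rectangle. For the boxes of an admissible array the listed conditions are
  exhaustive and assign consistent values, so neither the order of the tests nor the final
  \<open>undefined\<close> matters.\<close>

definition box_weight :: "real \<Rightarrow> int \<Rightarrow> int \<Rightarrow> sig_array \<Rightarrow> int \<Rightarrow> int \<Rightarrow> real" where
  "box_weight t m n \<Lambda> i j =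
    (let zero = zero_box m n \<Lambda>; one = one_box m n \<Lambda>; triv = trivial_box m n \<Lambda>;
         r = box_r \<Lambda> i j; c = box_c t \<Lambda> i j;
         hW = (if i = 0 then - \<infinity> else ereal (of_int (h \<Lambda> (i - 1) j)));
         vS = (if j = 0 then - \<infinity> else ereal (of_int (v \<Lambda> i (j - 1))));
         r1 = ereal (of_int (r - 1));
         exactly_one = ((hW = r1) \<noteq> (vS = r1));
         both_less = (hW < r1 \<and> vS < r1);
         SW_one = (one (i - 1) (j - 1) \<and> box_rbar \<Lambda> (i - 1) (j - 1) = r - 1);
         SW_zero = (zero (i - 1) (j - 1) \<and> box_rbar \<Lambda> (i - 1) (j - 1) = r - 1)
     in if triv i j
           \<or> one i j \<and> (one (i - 1) j \<or> one i (j - 1))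
           \<or> one i j \<and> SW_one
           \<or> zero i j \<and> SW_zero then 1
        else if zero i j \<and> exactly_one then t
        else if one i j \<and> triv (i - 1) j \<and> triv i (j - 1) \<and> exactly_one then 1 - t
        else if zero i j \<and> both_less then (t - c) / (1 - c)
        else if one i j \<and> both_less then (1 - t) / (1 - c)
        else if one i j \<and> SW_zero \<or> zero i j \<and> SW_one then 0
        else undefined)"

text \<open>\<open>U N t mu rho lam nu\<close> is $U(\mu\to\rho\mid\lambda\to\nu)$ for signatures of
  length \<open>N\<close>.\<close>

definition U ::
  "nat \<Rightarrow> real \<Rightarrow> int list \<Rightarrow> int list \<Rightarrow> int list \<Rightarrow> int list \<Rightarrow> real" where
  "U N t mu rho lam nu =
    (let m = sum_list nu - sum_list lam; n = sum_list mu - sum_list lam in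
     if lam \<prec> mu \<and> mu \<prec> rho \<and> lam \<prec> nu \<and> nu \<prec> rho
        \<and> sum_list nu - sum_list lam = sum_list rho - sum_list mu
        \<and> (\<exists>\<Lambda>. admissible N lam mu nu rho m n \<Lambda>)
     then let \<Lambda> = (THE \<Lambda>. admissible N lam mu nu rho m n \<Lambda>)
          in \<Prod>i\<in>{0..<m}. \<Prod>j\<in>{0..<n}. box_weight t m n \<Lambda> i j
     else 0)"

end

theory Submission imports Defs begin

text \<open>Transposing an array, \<open>\<Lambda>\<^sup>T (i, j) = \<Lambda> (j, i)\<close>, exchanges \<open>h\<close> with \<open>v\<close> and \<open>\<nu>\<close>
  with \<open>\<mu>\<close>, and every clause in the definitions of admissibility and of the weights is symmetric
  under this exchange. The asymmetric-looking ones use \<open>h\<close> as a name for a quantity that, on a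
  nontrivial box, equals its \<open>v\<close> counterpart: \<open>r(B)\<close> and \<open>r\<close>-bar. Hence transposition is a
  weight-preserving bijection between the arrays of the two sides (lemmas
  \<open>admissible_transpose\<close> and \<open>box_weight_transpose\<close>).

  What remains is that \<open>U\<close> evaluates the weights on \<^emph>\<open>the\<close> admissible array, so transposition
  carries the array of one side to that of the other only if admissible arrays are unique
  (lemma \<open>admissible_unique\<close>).
  A path of signatures whose moves take place at strictly increasing positions is determined by its
  two ends, so the left, bottom and right sides of the rectangle are determined. It remains to see
  that a row, together with the two end points of the next row, determines the next row. Follow
  the vertical moves along the row from left to right. Their position \<open>k\<close> changes only in
  boxes where it meets the horizontal move, and there it is kept or raised by one. If it is kept,
  it is kept until the end, since later horizontal moves have positions greater than
  \<open>k\<close>; if it is raised, it ends above \<open>k\<close>. So the final vertical move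
  reveals which of the two happened.\<close>

section \<open>Moves seen through counting functions\<close>

text \<open>A move at \<open>k\<close> changes the number of coordinates above \<open>x\<close> only for \<open>x = k\<close>, so these
  counts turn composition of moves into addition of independent indicator functions.\<close>

definition count_above :: "int list \<Rightarrow> int \<Rightarrow> nat" where
  "count_above \<kappa> x = size {#y \<in># mset \<kappa>. x < y#}"

lemma count_above_moves:
  assumes "moves \<kappa> k \<kappa>'"
  shows "count_above \<kappa>' x = count_above \<kappa> x + (if x = k then 1 else 0)"
proof -
  from assms have "k \<in># mset \<kappa>" and \<kappa>': "mset \<kappa>' = mset \<kappa> - {#k#} + {#k + 1#}"
    by (auto simp: moves_def)
  then obtain M where "mset \<kappa> = add_mset k M"
    by (metis insert_DiffM)
  with \<kappa>' show ?thesis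
    by (auto simp: count_above_def)
qed

lemma moves_position_unique:
  assumes "moves \<kappa> k \<kappa>'" and "moves \<kappa> l \<kappa>'"
  shows "k = l"
proof (rule ccontr)
  assume "k \<noteq> l"
  then show False
    using count_above_moves[OF assms(1), of k] count_above_moves[OF assms(2), of k] by simp
qed

lemma moved_position_eq: "moves \<kappa> k \<kappa>' \<Longrightarrow> moved_position \<kappa> \<kappa>' = k"
  unfolding moved_position_def by (blast intro: the_equality moves_position_unique)

lemma Sig_eqI:
  assumes "\<kappa> \<in> Sig N" and "\<kappa>' \<in> Sig N" and "mset \<kappa> = mset \<kappa>'"
  shows "\<kappa> = \<kappa>'"
proof -
  have "sorted (rev \<kappa>)" "sorted (rev \<kappa>')"
    using assms by (auto simp: Sig_def sorted_wrt_rev)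
  moreover have "mset (rev \<kappa>) = mset (rev \<kappa>')"
    using assms by simp
  ultimately have "rev \<kappa> = rev \<kappa>'"
    by (metis properties_for_sort)
  then show ?thesis by simp
qed

lemma moves_target_unique:
  assumes "moves \<kappa> k \<kappa>'" and "moves \<kappa> k \<kappa>''" and "\<kappa>' \<in> Sig N" and "\<kappa>'' \<in> Sig N"
  shows "\<kappa>' = \<kappa>''"
  using assms by (intro Sig_eqI[of _ N]) (auto simp: moves_def)

section \<open>Paths with increasing moves\<close>

lemma increasing_positions:
  fixes p :: "int \<Rightarrow> int"
  assumes "\<And>j. a \<le> j \<Longrightarrow> j + 1 < n \<Longrightarrow> p j < p (j + 1)" and "a \<le> i" and "i \<le> j" and "j < n"
  shows "p i \<le> p j" and "i < j \<Longrightarrow> p i < p j"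
proof -
  have "j < n \<longrightarrow> p i \<le> p j \<and> (i < j \<longrightarrow> p i < p j)"
    using \<open>i \<le> j\<close>
  proof (induction j rule: int_ge_induct)
    case (step j)
    have "p j < p (j + 1)" if "j + 1 < n"
      using assms(1)[of j] assms(2) step.hyps that by auto
    then show ?case using step by auto
  qed auto
  with \<open>j < n\<close> show "p i \<le> p j" and "i < j \<Longrightarrow> p i < p j" by auto
qed

text \<open>If two paths with common ends first diverged with a move at \<open>p i\<close> in the one and at a
  larger position in the other, then the number of coordinates above \<open>p i\<close> would grow along
  the first path and stay constant along the second, whose moves are all beyond \<open>p i\<close>.\<close>

lemma increasing_path_step_not_less:
  fixes a b :: "int \<Rightarrow> int list"
  assumes a: "\<And>j. i \<le> j \<Longrightarrow> j < n \<Longrightarrow> moves (a j) (p j) (a (j + 1))"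
    and b: "\<And>j. i \<le> j \<Longrightarrow> j < n \<Longrightarrow> moves (b j) (q j) (b (j + 1))"
    and q: "\<And>j. i \<le> j \<Longrightarrow> j + 1 < n \<Longrightarrow> q j < q (j + 1)"
    and "i < n" and start: "a i = b i" and finish: "a n = b n"
  shows "\<not> p i < q i"
proof
  assume less: "p i < q i"
  have "count_above (a (i + 1)) (p i) \<le> count_above (a j) (p i)" if "i + 1 \<le> j" "j \<le> n" for j
    using that
  proof (induction j rule: int_ge_induct)
    case (step j)
    then show ?case
      using count_above_moves[OF a, of j] by auto
  qed simp
  moreover have "count_above (a (i + 1)) (p i) = count_above (a i) (p i) + 1"
    using count_above_moves[OF a, of i] \<open>i < n\<close> by simp
  moreover have "count_above (b j) (p i) = count_above (b i) (p i)" if "i \<le> j" "j \<le> n" for j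
    using that
  proof (induction j rule: int_ge_induct)
    case (step j)
    have "p i < q j"
      using increasing_positions(1)[of i n q i j] q step less by auto
    then show ?case
      using step count_above_moves[OF b, of j] by auto
  qed simp
  ultimately show False
    using start finish \<open>i < n\<close>
    by (metis Suc_eq_plus1 Suc_n_not_le_n less_imp_le order_refl zless_imp_add1_zle)
qed

lemma increasing_path_unique:
  fixes a b :: "int \<Rightarrow> int list"
  assumes a: "\<And>j. 0 \<le> j \<Longrightarrow> j < n \<Longrightarrow> moves (a j) (p j) (a (j + 1))"
    and b: "\<And>j. 0 \<le> j \<Longrightarrow> j < n \<Longrightarrow> moves (b j) (q j) (b (j + 1))"
    and p: "\<And>j. 0 \<le> j \<Longrightarrow> j + 1 < n \<Longrightarrow> p j < p (j + 1)"
    and q: "\<And>j. 0 \<le> j \<Longrightarrow> j + 1 < n \<Longrightarrow> q j < q (j + 1)"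
    and aSig: "\<And>j. 0 \<le> j \<Longrightarrow> j \<le> n \<Longrightarrow> a j \<in> Sig N"
    and bSig: "\<And>j. 0 \<le> j \<Longrightarrow> j \<le> n \<Longrightarrow> b j \<in> Sig N"
    and start: "a 0 = b 0" and finish: "a n = b n"
    and "0 \<le> j" and "j \<le> n"
  shows "a j = b j"
  using \<open>0 \<le> j\<close> \<open>j \<le> n\<close>
proof (induction j rule: int_ge_induct)
  case base
  show ?case by (fact start)
next
  case (step j)
  then have eq: "a j = b j" by simp
  have "\<not> p j < q j"
    by (rule increasing_path_step_not_less[of j n a p b q]) (use a b q eq finish step in auto)
  moreover have "\<not> q j < p j"
    by (rule increasing_path_step_not_less[of j n b q a p]) (use a b p eq finish step in auto)
  ultimately have "p j = q j" by simp
  then show ?case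
    using moves_target_unique[of "a j" "p j" "a (j + 1)" "b (j + 1)" N]
      a[of j] b[of j] eq step aSig[of "j + 1"] bSig[of "j + 1"] by simp
qed

section \<open>Uniqueness of admissible arrays\<close>

context
  fixes N lam mu nu rho m n \<Lambda>
  assumes adm: "admissible N lam mu nu rho m n \<Lambda>"
begin

lemma admissible_in_PiE: "\<Lambda> \<in> {0..m} \<times> {0..n} \<rightarrow>\<^sub>E Sig N"
  using adm unfolding admissible_def by blast

lemma admissible_Sig:
  assumes "0 \<le> i" "i \<le> m" "0 \<le> j" "j \<le> n"
  shows "\<Lambda> (i, j) \<in> Sig N"
  using PiE_mem[OF admissible_in_PiE, of "(i, j)"] assms by simp

lemma admissible_corners:
  "\<Lambda> (0, 0) = lam" "\<Lambda> (m, 0) = nu" "\<Lambda> (0, n) = mu" "\<Lambda> (m, n) = rho"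
proof -
  have "\<Lambda> (0, 0) = lam \<and> \<Lambda> (m, 0) = nu \<and> \<Lambda> (0, n) = mu \<and> \<Lambda> (m, n) = rho"
    using adm unfolding admissible_def by (elim conjE) (intro conjI)
  then show "\<Lambda> (0, 0) = lam" "\<Lambda> (m, 0) = nu" "\<Lambda> (0, n) = mu" "\<Lambda> (m, n) = rho"
    by simp_all
qed

lemma admissible_moves_h:
  assumes "0 \<le> i" "i < m" "0 \<le> j" "j \<le> n"
  shows "moves (\<Lambda> (i, j)) (h \<Lambda> i j) (\<Lambda> (i + 1, j))"
proof -
  have "\<forall>i\<in>{0..<m}. \<forall>j\<in>{0..n}. \<exists>k. moves (\<Lambda> (i, j)) k (\<Lambda> (i + 1, j))"
    using adm unfolding admissible_def by blast
  then obtain k where "moves (\<Lambda> (i, j)) k (\<Lambda> (i + 1, j))"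
    using assms by (meson atLeastAtMost_iff atLeastLessThan_iff)
  then show ?thesis using moved_position_eq unfolding h_def by simp
qed

lemma admissible_moves_v:
  assumes "0 \<le> i" "i \<le> m" "0 \<le> j" "j < n"
  shows "moves (\<Lambda> (i, j)) (v \<Lambda> i j) (\<Lambda> (i, j + 1))"
proof -
  have "\<forall>i\<in>{0..m}. \<forall>j\<in>{0..<n}. \<exists>k. moves (\<Lambda> (i, j)) k (\<Lambda> (i, j + 1))"
    using adm unfolding admissible_def by blast
  then obtain k where "moves (\<Lambda> (i, j)) k (\<Lambda> (i, j + 1))"
    using assms by (meson atLeastAtMost_iff atLeastLessThan_iff)
  then show ?thesis using moved_position_eq unfolding v_def by simp
qed

lemma admissible_h_increasing:
  assumes "0 \<le> i" "i + 1 < m" "0 \<le> j" "j \<le> n"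
  shows "h \<Lambda> i j < h \<Lambda> (i + 1) j"
proof -
  have "\<forall>i\<in>{0..<m - 1}. \<forall>j\<in>{0..n}. h \<Lambda> i j < h \<Lambda> (i + 1) j"
    using adm unfolding admissible_def by blast
  then show ?thesis using assms by simp
qed

lemma admissible_v_increasing:
  assumes "0 \<le> i" "i \<le> m" "0 \<le> j" "j + 1 < n"
  shows "v \<Lambda> i j < v \<Lambda> i (j + 1)"
proof -
  have "\<forall>i\<in>{0..m}. \<forall>j\<in>{0..<n - 1}. v \<Lambda> i j < v \<Lambda> i (j + 1)"
    using adm unfolding admissible_def by blast
  then show ?thesis using assms by simp
qed

text \<open>Both ways around a box have the same total effect, so in terms of counts the two
  pairs of moves agree as multisets; this pins down the moves on the far sides unless the
  two near ones coincide.\<close>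

lemma admissible_v_across_unequal:
  assumes "0 \<le> i" "i < m" "0 \<le> j" "j < n" and ne: "h \<Lambda> i j \<noteq> v \<Lambda> i j"
  shows "v \<Lambda> (i + 1) j = v \<Lambda> i j"
proof -
  let ?x = "v \<Lambda> i j"
  have "count_above (\<Lambda> (i + 1, j)) ?x = count_above (\<Lambda> (i, j)) ?x"
    using count_above_moves[OF admissible_moves_h, of i j ?x] assms by auto
  moreover have "count_above (\<Lambda> (i, j + 1)) ?x = count_above (\<Lambda> (i, j)) ?x + 1"
    using count_above_moves[OF admissible_moves_v, of i j ?x] assms by auto
  moreover have "count_above (\<Lambda> (i + 1, j + 1)) ?x \<ge> count_above (\<Lambda> (i, j + 1)) ?x"
    using count_above_moves[OF admissible_moves_h, of i "j + 1" ?x] assms by auto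
  moreover have "count_above (\<Lambda> (i + 1, j + 1)) ?x
      = count_above (\<Lambda> (i + 1, j)) ?x + (if ?x = v \<Lambda> (i + 1) j then 1 else 0)"
    using count_above_moves[OF admissible_moves_v, of "i + 1" j ?x] assms by auto
  ultimately show ?thesis by (auto split: if_splits)
qed

lemma admissible_collision:
  assumes "0 \<le> i" "i < m" "0 \<le> j" "j < n" and "h \<Lambda> i j = v \<Lambda> i j"
  shows "h \<Lambda> i (j + 1) = v \<Lambda> (i + 1) j"
    and "v \<Lambda> (i + 1) j = v \<Lambda> i j \<or> v \<Lambda> (i + 1) j = v \<Lambda> i j + 1"
proof -
  have "\<forall>i\<in>{0..<m}. \<forall>j\<in>{0..<n}. h \<Lambda> i j = v \<Lambda> i j \<longrightarrow>
        h \<Lambda> i (j + 1) = v \<Lambda> (i + 1) j \<and> h \<Lambda> i (j + 1) \<in> {h \<Lambda> i j, h \<Lambda> i j + 1}"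
    using adm unfolding admissible_def by blast
  then have "h \<Lambda> i (j + 1) = v \<Lambda> (i + 1) j \<and> h \<Lambda> i (j + 1) \<in> {h \<Lambda> i j, h \<Lambda> i j + 1}"
    using assms by (meson atLeastLessThan_iff)
  then show "h \<Lambda> i (j + 1) = v \<Lambda> (i + 1) j"
    and "v \<Lambda> (i + 1) j = v \<Lambda> i j \<or> v \<Lambda> (i + 1) j = v \<Lambda> i j + 1"
    using assms(5) by auto
qed

lemma admissible_v_mono:
  assumes "0 \<le> i" "i \<le> i'" "i' \<le> m" "0 \<le> j" "j < n"
  shows "v \<Lambda> i j \<le> v \<Lambda> i' j"
  using assms(2,3)
proof (induction i' rule: int_ge_induct)
  case (step i')
  then have "v \<Lambda> i' j \<le> v \<Lambda> (i' + 1) j"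
    using admissible_v_across_unequal[of i' j] admissible_collision(2)[of i' j] assms
    by (cases "h \<Lambda> i' j = v \<Lambda> i' j") auto
  then show ?case using step by simp
qed simp

text \<open>After a zero-box the vertical move meets only larger horizontal positions.\<close>

lemma admissible_v_frozen:
  assumes "0 \<le> i" "i < m" "0 \<le> j" "j < n" and keep: "v \<Lambda> (i + 1) j = h \<Lambda> i j"
    and "i + 1 \<le> i'" "i' \<le> m"
  shows "v \<Lambda> i' j = h \<Lambda> i j"
  using assms(6,7)
proof (induction i' rule: int_ge_induct)
  case base
  show ?case by (fact keep)
next
  case (step i')
  have "h \<Lambda> i j < h \<Lambda> i' j"
    using increasing_positions(2)[of 0 m "\<lambda>i. h \<Lambda> i j" i i'] admissible_h_increasing assms step
    by auto
  then show ?case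
    using admissible_v_across_unequal[of i' j] step assms by auto
qed

end

text \<open>The decision taken in a row shows at its right end: one array cannot keep the
  vertical position at a collision where the other raises it, because the two would leave the row at different positions.\<close>

lemma admissible_choice_not_less:
  assumes A: "admissible N lam mu nu rho m n \<Lambda>" and B: "admissible N lam mu nu rho m n \<Lambda>'"
    and "0 \<le> i" "i < m" "0 \<le> j" "j < n"
    and eq_h: "h \<Lambda> i j = v \<Lambda> i j"
    and eq_v: "v \<Lambda> i j = v \<Lambda>' i j"
    and exit: "v \<Lambda> m j = v \<Lambda>' m j"
    and keep: "v \<Lambda> (i + 1) j = v \<Lambda> i j"
  shows "\<not> v \<Lambda> i j < v \<Lambda>' (i + 1) j"
proof -
  have "v \<Lambda> m j = v \<Lambda> i j"
    using admissible_v_frozen[OF A, of i j m] assms by auto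
  moreover have "v \<Lambda>' (i + 1) j \<le> v \<Lambda>' m j"
    using admissible_v_mono[OF B, of "i + 1" m j] assms by auto
  ultimately show ?thesis using exit by auto
qed

lemma admissible_next_row_unique:
  assumes A: "admissible N lam mu nu rho m n \<Lambda>" and B: "admissible N lam mu nu rho m n \<Lambda>'"
    and "0 \<le> j" "j < n"
    and row: "\<And>i. 0 \<le> i \<Longrightarrow> i \<le> m \<Longrightarrow> \<Lambda> (i, j) = \<Lambda>' (i, j)"
    and left: "\<Lambda> (0, j + 1) = \<Lambda>' (0, j + 1)"
    and right: "\<Lambda> (m, j + 1) = \<Lambda>' (m, j + 1)"
    and "0 \<le> i" "i \<le> m"
  shows "\<Lambda> (i, j + 1) = \<Lambda>' (i, j + 1)"
  using \<open>0 \<le> i\<close> \<open>i \<le> m\<close>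
proof (induction i rule: int_ge_induct)
  case base
  show ?case by (fact left)
next
  case (step i)
  then have i: "0 \<le> i" "i < m" by auto
  have eq_v: "v \<Lambda> i j = v \<Lambda>' i j"
    using step row[of i] by (simp add: v_def)
  have eq_h: "h \<Lambda> i j = h \<Lambda>' i j"
    using step row[of i] row[of "i + 1"] by (simp add: h_def)
  have exit: "v \<Lambda> m j = v \<Lambda>' m j"
    using right row[of m] i by (simp add: v_def)
  have "v \<Lambda> (i + 1) j = v \<Lambda>' (i + 1) j"
  proof (cases "h \<Lambda> i j = v \<Lambda> i j")
    case False
    then show ?thesis
      using admissible_v_across_unequal[OF A, of i j] admissible_v_across_unequal[OF B, of i j]
        i \<open>0 \<le> j\<close> \<open>j < n\<close> eq_h eq_v by simp
  next
    case True
    then have True': "h \<Lambda>' i j = v \<Lambda>' i j" using eq_h eq_v by simp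
    note ij = i \<open>0 \<le> j\<close> \<open>j < n\<close>
    note admissible_collision(2)[OF A ij True]
    moreover note admissible_collision(2)[OF B ij True', folded eq_v]
    moreover note admissible_choice_not_less[OF A B ij True eq_v exit]
    moreover note admissible_choice_not_less[OF B A ij True' eq_v[symmetric] exit[symmetric],
        folded eq_v]
    ultimately show ?thesis by linarith
  qed
  then show ?case
    using moves_target_unique[of "\<Lambda> (i + 1, j)" "v \<Lambda> (i + 1) j" "\<Lambda> (i + 1, j + 1)"
        "\<Lambda>' (i + 1, j + 1)" N]
      admissible_moves_v[OF A, of "i + 1" j] admissible_moves_v[OF B, of "i + 1" j]
      admissible_Sig[OF A, of "i + 1" "j + 1"] admissible_Sig[OF B, of "i + 1" "j + 1"]
      row[of "i + 1"] i \<open>0 \<le> j\<close> \<open>j < n\<close> by simp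
qed

lemma admissible_unique:
  assumes A: "admissible N lam mu nu rho m n \<Lambda>" and B: "admissible N lam mu nu rho m n \<Lambda>'"
    and "0 \<le> m" "0 \<le> n"
  shows "\<Lambda> = \<Lambda>'"
proof -
  note cornersA = admissible_corners[OF A] and cornersB = admissible_corners[OF B]
  have column: "\<Lambda> (i, j) = \<Lambda>' (i, j)" if "i = 0 \<or> i = m" "0 \<le> j" "j \<le> n" for i j
  proof -
    have i: "0 \<le> i" "i \<le> m" using that \<open>0 \<le> m\<close> by auto
    have start: "\<Lambda> (i, 0) = \<Lambda>' (i, 0)" and finish: "\<Lambda> (i, n) = \<Lambda>' (i, n)"
      using that(1) cornersA cornersB by metis+
    show ?thesis
      by (rule increasing_path_unique[of n "\<lambda>j. \<Lambda> (i, j)" "v \<Lambda> i" "\<lambda>j. \<Lambda>' (i, j)" "v \<Lambda>' i" N])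
        (assumption | rule i that start finish
          admissible_moves_v[OF A] admissible_v_increasing[OF A] admissible_Sig[OF A]
          admissible_moves_v[OF B] admissible_v_increasing[OF B] admissible_Sig[OF B])+
  qed
  have bottom: "\<Lambda> (i, 0) = \<Lambda>' (i, 0)" if "0 \<le> i" "i \<le> m" for i
  proof -
    have start: "\<Lambda> (0, 0) = \<Lambda>' (0, 0)" and finish: "\<Lambda> (m, 0) = \<Lambda>' (m, 0)"
      using cornersA cornersB by metis+
    show ?thesis
      by (rule increasing_path_unique[of m "\<lambda>i. \<Lambda> (i, 0)" "\<lambda>i. h \<Lambda> i 0"
            "\<lambda>i. \<Lambda>' (i, 0)" "\<lambda>i. h \<Lambda>' i 0" N])
        (assumption | rule order_refl that start finish \<open>0 \<le> n\<close>
          admissible_moves_h[OF A] admissible_h_increasing[OF A] admissible_Sig[OF A]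
          admissible_moves_h[OF B] admissible_h_increasing[OF B] admissible_Sig[OF B])+
  qed
  have row: "\<forall>i. 0 \<le> i \<longrightarrow> i \<le> m \<longrightarrow> \<Lambda> (i, j) = \<Lambda>' (i, j)" if "0 \<le> j" "j \<le> n" for j
    using that
  proof (induction j rule: int_ge_induct)
    case base
    then show ?case using bottom by simp
  next
    case (step j)
    then show ?case
      using admissible_next_row_unique[OF A B, of j] column[of 0 "j + 1"] column[of m "j + 1"]
      by auto
  qed
  show ?thesis
    by (rule PiE_ext[OF admissible_in_PiE[OF A] admissible_in_PiE[OF B]]) (use row in auto)
qed

section \<open>Transposition\<close>

definition transpose_array :: "sig_array \<Rightarrow> sig_array" where
  "transpose_array \<Lambda> = (\<lambda>(i, j). \<Lambda> (j, i))"

lemma transpose_array_apply: "transpose_array \<Lambda> (i, j) = \<Lambda> (j, i)"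
  by (simp add: transpose_array_def)

lemma h_transpose: "h (transpose_array \<Lambda>) i j = v \<Lambda> j i"
  by (simp add: h_def v_def transpose_array_apply)

lemma v_transpose: "v (transpose_array \<Lambda>) i j = h \<Lambda> j i"
  by (simp add: h_def v_def transpose_array_apply)

lemma admissible_transpose:
  assumes adm: "admissible N lam mu nu rho m n \<Lambda>"
  shows "admissible N lam nu mu rho n m (transpose_array \<Lambda>)"
proof -
  have "transpose_array \<Lambda> \<in> {0..n} \<times> {0..m} \<rightarrow>\<^sub>E Sig N"
    using admissible_in_PiE[OF adm] by (auto simp: PiE_iff transpose_array_def extensional_def)
  moreover have "\<forall>i\<in>{0..<n}. \<forall>j\<in>{0..m}. \<exists>k. moves (\<Lambda> (j, i)) k (\<Lambda> (j, i + 1))"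
    using admissible_moves_v[OF adm] by (meson atLeastAtMost_iff atLeastLessThan_iff)
  moreover have "\<forall>i\<in>{0..n}. \<forall>j\<in>{0..<m}. \<exists>k. moves (\<Lambda> (j, i)) k (\<Lambda> (j + 1, i))"
    using admissible_moves_h[OF adm] by (meson atLeastAtMost_iff atLeastLessThan_iff)
  moreover have "\<forall>i\<in>{0..<n - 1}. \<forall>j\<in>{0..m}. v \<Lambda> j i < v \<Lambda> j (i + 1)"
    using admissible_v_increasing[OF adm] by auto
  moreover have "\<forall>i\<in>{0..n}. \<forall>j\<in>{0..<m - 1}. h \<Lambda> j i < h \<Lambda> (j + 1) i"
    using admissible_h_increasing[OF adm] by auto
  moreover have "\<forall>i\<in>{0..<n}. \<forall>j\<in>{0..<m}. v \<Lambda> j i = h \<Lambda> j i \<longrightarrow>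
      v \<Lambda> (j + 1) i = h \<Lambda> j (i + 1) \<and> v \<Lambda> (j + 1) i \<in> {v \<Lambda> j i, v \<Lambda> j i + 1}"
  proof (intro ballI impI)
    fix i j
    assume "i \<in> {0..<n}" "j \<in> {0..<m}" "v \<Lambda> j i = h \<Lambda> j i"
    then show "v \<Lambda> (j + 1) i = h \<Lambda> j (i + 1) \<and> v \<Lambda> (j + 1) i \<in> {v \<Lambda> j i, v \<Lambda> j i + 1}"
      using admissible_collision[OF adm, of j i] by simp
  qed
  ultimately show ?thesis
    unfolding admissible_def h_transpose v_transpose transpose_array_apply
    using admissible_corners[OF adm] by (intro conjI) assumption+
qed

lemma zero_box_transpose: "zero_box n m (transpose_array \<Lambda>) j i \<longleftrightarrow> zero_box m n \<Lambda> i j"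
  unfolding zero_box_def h_transpose v_transpose by auto

lemma one_box_transpose: "one_box n m (transpose_array \<Lambda>) j i \<longleftrightarrow> one_box m n \<Lambda> i j"
  unfolding one_box_def h_transpose v_transpose by auto

lemma trivial_box_transpose: "trivial_box n m (transpose_array \<Lambda>) j i \<longleftrightarrow> trivial_box m n \<Lambda> i j"
  unfolding trivial_box_def zero_box_transpose one_box_transpose ..

text \<open>On a trivial box \<open>h\<close> and \<open>v\<close> need not agree, so transposition may change \<open>r\<close>
  and \<open>c\<close>, but there the weight is \<open>1\<close> whatever they are. On the other boxes both agree, and so
  does \<open>r\<close>-bar of the south-west box wherever the weight consults it.\<close>

lemma box_weight_transpose:
  "box_weight t n m (transpose_array \<Lambda>) j i = box_weight t m n \<Lambda> i j"
proof (cases "trivial_box m n \<Lambda> i j")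
  case True
  then show ?thesis
    by (simp add: box_weight_def Let_def trivial_box_transpose)
next
  case False
  then have hv: "v \<Lambda> i j = h \<Lambda> i j"
    by (auto simp: trivial_box_def zero_box_def one_box_def)
  have r: "box_r (transpose_array \<Lambda>) j i = box_r \<Lambda> i j"
    and c: "box_c t (transpose_array \<Lambda>) j i = box_c t \<Lambda> i j"
    by (simp_all add: box_c_def box_r_def h_transpose hv transpose_array_apply)
  have SW: "P (i - 1) (j - 1) \<and> box_rbar (transpose_array \<Lambda>) (j - 1) (i - 1) = x
      \<longleftrightarrow> P (i - 1) (j - 1) \<and> box_rbar \<Lambda> (i - 1) (j - 1) = x"
    if "P = zero_box m n \<Lambda> \<or> P = one_box m n \<Lambda>" for P x
    using that by (auto simp: box_rbar_def h_transpose zero_box_def one_box_def)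
  show ?thesis
    unfolding box_weight_def Let_def zero_box_transpose one_box_transpose trivial_box_transpose
      r c h_transpose v_transpose SW[OF disjI1[OF refl]] SW[OF disjI2[OF refl]]
    by (intro if_cong refl) argo+
qed

theorem proposition3p5:
  fixes t :: real and N :: nat and lam mu nu rho :: "int list"
  assumes "0 \<le> t" and "t < 1" and "N \<ge> 1"
    and "lam \<in> Sig N" and "mu \<in> Sig N" and "nu \<in> Sig N" and "rho \<in> Sig N"
    and "lam \<prec> mu" and "mu \<prec> rho" and "lam \<prec> nu" and "nu \<prec> rho"
  shows "U N t mu rho lam nu = U N t nu rho lam mu"
proof -
  define m where "m = sum_list nu - sum_list lam"
  define n where "n = sum_list mu - sum_list lam"
  have sum_mono: "sum_list \<kappa> \<le> sum_list \<kappa>'" if "\<kappa> \<prec> \<kappa>'" for \<kappa> \<kappa>' :: "int list"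
    using that by (intro sum_list_mono2) (auto simp: interlaces_def)
  have m: "0 \<le> m" and n: "0 \<le> n"
    using sum_mono assms by (auto simp: m_def n_def)
  let ?P = "admissible N lam mu nu rho m n"
  let ?Q = "admissible N lam nu mu rho n m"
  have ex: "(\<exists>\<Lambda>. ?P \<Lambda>) \<longleftrightarrow> (\<exists>\<Lambda>. ?Q \<Lambda>)"
    using admissible_transpose by blast
  have weights: "(\<Prod>i\<in>{0..<m}. \<Prod>j\<in>{0..<n}. box_weight t m n (THE \<Lambda>. ?P \<Lambda>) i j)
      = (\<Prod>j\<in>{0..<n}. \<Prod>i\<in>{0..<m}. box_weight t n m (THE \<Lambda>. ?Q \<Lambda>) j i)" if P: "?P \<Lambda>" for \<Lambda>
  proof -
    have "(THE \<Lambda>. ?P \<Lambda>) = \<Lambda>"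
      using P admissible_unique m n by (intro the_equality) blast+
    moreover have "(THE \<Lambda>. ?Q \<Lambda>) = transpose_array \<Lambda>"
      using admissible_transpose[OF P] admissible_unique m n by (intro the_equality) blast+
    ultimately show ?thesis
      by (simp add: box_weight_transpose prod.swap[of _ "{0..<n}"])
  qed
  have "sum_list nu - sum_list lam = sum_list rho - sum_list mu
      \<longleftrightarrow> sum_list mu - sum_list lam = sum_list rho - sum_list nu"
    by auto
  then have lhs: "U N t mu rho lam nu = (if m = sum_list rho - sum_list mu \<and> (\<exists>\<Lambda>. ?P \<Lambda>)
      then \<Prod>i\<in>{0..<m}. \<Prod>j\<in>{0..<n}. box_weight t m n (THE \<Lambda>. ?P \<Lambda>) i j else 0)"
    and rhs: "U N t nu rho lam mu = (if m = sum_list rho - sum_list mu \<and> (\<exists>\<Lambda>. ?Q \<Lambda>)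
      then \<Prod>j\<in>{0..<n}. \<Prod>i\<in>{0..<m}. box_weight t n m (THE \<Lambda>. ?Q \<Lambda>) j i else 0)"
    using assms unfolding U_def Let_def m_def n_def by simp_all
  show ?thesis
  proof (cases "\<exists>\<Lambda>. ?P \<Lambda>")
    case True
    then obtain \<Lambda> where "?P \<Lambda>" by blast
    moreover from True have "\<exists>\<Lambda>. ?Q \<Lambda>" by (simp only: ex)
    ultimately show ?thesis
      using True by (simp only: lhs rhs weights)
  next
    case False
    moreover from False have "\<not> (\<exists>\<Lambda>. ?Q \<Lambda>)" by (simp only: ex not_False_eq_True)
    ultimately show ?thesis
      by (simp only: lhs rhs simp_thms if_False)
  qed
qed

end
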